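(* Let $\mu_1,\mu_2>0$, $q>0$, and let $a>1$, $b>1$, $c\ge0$ satisfy $(a-1)(b-1)\ge(c-1)^2$. Suppose that $2(a-c)q>(ab-c^2)\mu_2$ and $Q_a\le-c\mu_2-a\mu_1+q$. Then an optimal distribution for the problem $$v_P(q;\theta)=\sup_{\mathbb P\in\mathcal F(\theta)}\mathbb E_{\mathbb P}[(X_1+X_2-q)_+]$$ is the one taking the value $(0,q-Q_a)$ with probability $p_1=\frac{a-1}{2a}+\frac{q(a-1)+\mu_2(c-a)}{2aQ_a}$, the value $(0,q+Q_a)$ with probability $p_2=\frac{a-1}{2a}-\frac{q(a-1)+\mu_2(c-a)}{2aQ_a}$, and the value $(a\mu_1,c\mu_2)$ with probability $p_3=\frac1a$. The optimal value is $$v_P(q;\theta)=\frac{a-1}{2a}\left(\frac{a-c}{a-1}\mu_2-(q-Q_a)\right).$$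
   Context: $(t)_+=\max\{t,0\}$. $\theta=(\mu_1,\mu_2,a\mu_1^2,b\mu_2^2,c\mu_1\mu_2)$, and $\mathcal F(\theta)$ is the set of all probability distributions $\mathbb P$ of a random vector $(X_1,X_2)$ supported on $\mathbb R_+^2=[0,\infty)^2$ such that $\mathbb E_{\mathbb P}[X_1]=\mu_1$, $\mathbb E_{\mathbb P}[X_2]=\mu_2$, $\mathbb E_{\mathbb P}[X_1^2]=a\mu_1^2$, $\mathbb E_{\mathbb P}[X_2^2]=b\mu_2^2$, $\mathbb E_{\mathbb P}[X_1X_2]=c\mu_1\mu_2$. "Optimal distribution" means a distribution belonging to $\mathcal F(\theta)$ at which the supremum is attained. Notation: $$Q_a=\sqrt{q^2-2q\tfrac{a-c}{a-1}\mu_2+\tfrac{ab-c^2}{a-1}\mu_2^2}.$$ *)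

theory Defs
  imports "HOL-Probability.Probability"
begin

text \<open>
  Moment vectors are ordered as \<open>(E X\<^sub>1, E X\<^sub>2, E X\<^sub>1\<^sup>2, E X\<^sub>2\<^sup>2, E X\<^sub>1X\<^sub>2)\<close>. A distribution of \<open>(X\<^sub>1, X\<^sub>2)\<close> is a
  Borel probability measure on the plane, and \<open>X\<^sub>1\<close>, \<open>X\<^sub>2\<close> are the coordinate projections.
  Using \<^const>\<open>has_bochner_integral\<close> makes every moment exist, not merely have the given value of
  the total integral operator.
\<close>

type_synonym moments = "real \<times> real \<times> real \<times> real \<times> real"

fun moment_set :: "moments \<Rightarrow> (real \<times> real) measure set" where
  "moment_set (m1, m2, s1, s2, s12) =
    {M. prob_space M \<and> sets M = sets borel \<and>
        (AE x in M. 0 \<le> fst x \<and> 0 \<le> snd x) \<and>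
        has_bochner_integral M (\<lambda>x. fst x) m1 \<and>
        has_bochner_integral M (\<lambda>x. snd x) m2 \<and>
        has_bochner_integral M (\<lambda>x. (fst x)\<^sup>2) s1 \<and>
        has_bochner_integral M (\<lambda>x. (snd x)\<^sup>2) s2 \<and>
        has_bochner_integral M (\<lambda>x. fst x * snd x) s12}"

definition expected_excess :: "real \<Rightarrow> (real \<times> real) measure \<Rightarrow> real" where
  "expected_excess q M = (LINT x|M. max (fst x + snd x - q) 0)"

text \<open>
  The supremum is taken in the extended reals, so that it needs no nonemptiness or boundedness
  side condition. On \<^const>\<open>moment_set\<close> the integrand of \<^const>\<open>expected_excess\<close> is dominated by
  \<open>|X\<^sub>1| + |X\<^sub>2| + |q|\<close>, hence integrable.
\<close>

definition v_P :: "real \<Rightarrow> moments \<Rightarrow> ereal" where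
  "v_P q \<theta> = (SUP M\<in>moment_set \<theta>. ereal (expected_excess q M))"

definition optimal_distribution :: "real \<Rightarrow> moments \<Rightarrow> (real \<times> real) measure \<Rightarrow> bool" where
  "optimal_distribution q \<theta> M \<longleftrightarrow> M \<in> moment_set \<theta> \<and> ereal (expected_excess q M) = v_P q \<theta>"

text \<open>
  Probabilities of coinciding points in the list are added up. The result is meaningful only if
  \<^const>\<open>pmf_of_list_wf\<close> holds for the list (nonnegative weights with sum 1).
\<close>

definition discrete_distribution :: "((real \<times> real) \<times> real) list \<Rightarrow> (real \<times> real) measure" where
  "discrete_distribution xps = distr (measure_pmf (pmf_of_list xps)) borel (\<lambda>x. x)"

text \<open>
  The radicand is a square plus \<open>a((a - 1)(b - 1) - (c - 1)\<^sup>2) \<mu>\<^sub>2\<^sup>2 / (a - 1)\<^sup>2\<close>, hence nonnegative in the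
  feasible range of \<open>(a, b, c)\<close>. It may vanish; the atoms \<open>(0, q \<plusminus> Q)\<close> then coincide, and a
  weight containing \<open>0 / 0\<close> is read with the convention \<open>x / 0 = 0\<close>.
\<close>

definition Q_a :: "real \<Rightarrow> real \<Rightarrow> real \<Rightarrow> real \<Rightarrow> real \<Rightarrow> real" where
  "Q_a q \<mu>2 a b c =
    sqrt (q\<^sup>2 - 2 * q * ((a - c) / (a - 1)) * \<mu>2 + ((a * b - c\<^sup>2) / (a - 1)) * \<mu>2\<^sup>2)"

end

theory Submission
  imports Defs
begin

text \<open>
  Put \<open>w = X\<^sub>2 + k X\<^sub>1 - q\<close> with \<open>k = (q - Q - c \<mu>\<^sub>2) / (a \<mu>\<^sub>1)\<close>, so that the line \<open>w = -Q\<close> passes through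
  the atoms \<open>(0, q - Q)\<close> and \<open>(a \<mu>\<^sub>1, c \<mu>\<^sub>2)\<close>. The hypothesis on \<open>Q\<close> says \<open>k \<ge> 1\<close>, so on the support
  the excess is at most \<open>max w 0 = (\<bar>w\<bar> + w) / 2\<close>, and its expectation is at most
  \<open>(sqrt (E w\<^sup>2) + E w) / 2\<close>, which is the claimed value since the moments give \<open>E w\<^sup>2 = Q\<^sup>2\<close>.
  The three-atom distribution attains the bound because \<open>\<bar>w\<bar> = Q\<close> on its atoms and \<open>w \<le> 0\<close> on the
  only atom with \<open>X\<^sub>1 > 0\<close>.
\<close>

text \<open>Each list entry is counted only at its own point of \<open>A\<close>, so a double sum
  over points and entries collapses to a sum over entries. Repeated points are covered, which
  matters because the atoms \<open>(0, q - Q)\<close> and \<open>(0, q + Q)\<close> coincide when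
  \<open>Q = 0\<close>.\<close>

lemma sum_filter_weights:
  fixes f :: "'a \<Rightarrow> real"
  assumes "finite A" "fst ` set xs \<subseteq> A"
  shows "(\<Sum>x\<in>A. f x * sum_list (map snd (filter (\<lambda>z. fst z = x) xs)))
       = (\<Sum>(x, p)\<leftarrow>xs. p * f x)"
  using assms(2)
proof (induction xs)
  case Nil
  then show ?case by simp
next
  case (Cons z xs)
  have "(\<Sum>x\<in>A. f x * sum_list (map snd (filter (\<lambda>z. fst z = x) (z # xs))))
     = (\<Sum>x\<in>A. (if x = fst z then f x * snd z else 0)
          + f x * sum_list (map snd (filter (\<lambda>z. fst z = x) xs)))"
    by (intro sum.cong) (auto simp: algebra_simps)
  also have "\<dots> = f (fst z) * snd z + (\<Sum>(x, p)\<leftarrow>xs. p * f x)"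
    using Cons assms(1) by (simp add: sum.distrib)
  also have "\<dots> = (\<Sum>(x, p)\<leftarrow>z # xs. p * f x)"
    by (cases z) simp
  finally show ?case .
qed

lemma has_bochner_integral_discrete_distribution:
  fixes f :: "real \<times> real \<Rightarrow> real"
  assumes wf: "pmf_of_list_wf xs" and f: "f \<in> borel_measurable borel"
  shows "has_bochner_integral (discrete_distribution xs) f (\<Sum>(x, p)\<leftarrow>xs. p * f x)"
proof -
  have supp: "set_pmf (pmf_of_list xs) \<subseteq> fst ` set xs"
    using set_pmf_of_list[OF wf] by simp
  have "integrable (measure_pmf (pmf_of_list xs)) f"
    using finite_subset[OF supp] by (intro integrable_measure_pmf_finite) auto
  moreover have "(\<integral>x. f x \<partial>measure_pmf (pmf_of_list xs)) = (\<Sum>(x, p)\<leftarrow>xs. p * f x)"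
  proof -
    have "(\<integral>x. f x \<partial>measure_pmf (pmf_of_list xs))
        = (\<Sum>x\<in>fst ` set xs. f x * pmf (pmf_of_list xs) x)"
      using supp by (intro integral_measure_pmf_real) auto
    also have "\<dots> = (\<Sum>(x, p)\<leftarrow>xs. p * f x)"
      unfolding pmf_pmf_of_list[OF wf] by (rule sum_filter_weights) auto
    finally show ?thesis .
  qed
  ultimately show ?thesis
    using f unfolding discrete_distribution_def has_bochner_integral_iff
    by (auto simp: integrable_distr_eq integral_distr)
qed

lemma AE_discrete_distribution:
  assumes wf: "pmf_of_list_wf xs" and P: "Measurable.pred borel P"
    and "\<And>x. x \<in> fst ` set xs \<Longrightarrow> P x"
  shows "AE x in discrete_distribution xs. P x"
proof -
  have "AE x in measure_pmf (pmf_of_list xs). P x"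
    using set_pmf_of_list[OF wf] assms(3) by (auto simp: AE_measure_pmf_iff)
  then show ?thesis
    using P unfolding discrete_distribution_def by (subst AE_distr_iff) (auto simp: pred_def)
qed

lemma prob_space_discrete_distribution: "prob_space (discrete_distribution xs)"
  unfolding discrete_distribution_def by (intro measure_pmf.prob_space_distr) simp

text \<open>This is nonnegativity of the variance of \<open>\<bar>f\<bar>\<close>, whose square is
  that of \<open>f\<close>.\<close>

lemma (in prob_space) expectation_abs_le_sqrt:
  fixes f :: "'a \<Rightarrow> real"
  assumes "integrable M f" "integrable M (\<lambda>x. (f x)\<^sup>2)"
  shows "expectation (\<lambda>x. \<bar>f x\<bar>) \<le> sqrt (expectation (\<lambda>x. (f x)\<^sup>2))"
proof -
  have "0 \<le> variance (\<lambda>x. \<bar>f x\<bar>)"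
    by (rule variance_positive)
  also have "\<dots> = expectation (\<lambda>x. (f x)\<^sup>2) - (expectation (\<lambda>x. \<bar>f x\<bar>))\<^sup>2"
    using assms by (subst variance_eq) auto
  finally show ?thesis
    by (intro real_le_rsqrt) simp
qed

text \<open>Upper bound for an arbitrary slope \<open>k \<ge> 1\<close>, to be specialised later.
  The radicand is \<open>E w\<^sup>2\<close> expanded in the five moments and
  \<open>m2 + k * m1 - q\<close> is \<open>E w\<close>; nonnegativity of \<open>X\<^sub>1\<close> is
  what turns \<open>k \<ge> 1\<close> into a pointwise bound.\<close>

lemma expected_excess_le:
  fixes k m1 m2 s1 s2 s12 q :: real
  assumes M: "M \<in> moment_set (m1, m2, s1, s2, s12)" and k: "k \<ge> 1"
  shows "expected_excess q M
    \<le> (sqrt (s2 + k\<^sup>2 * s1 + q\<^sup>2 + 2 * k * s12 - 2 * q * m2 - 2 * q * k * m1)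
        + (m2 + k * m1 - q)) / 2"
proof -
  interpret prob_space M using M by simp
  let ?w = "\<lambda>x. snd x + k * fst x - q"
  let ?S = "s2 + k\<^sup>2 * s1 + q\<^sup>2 + 2 * k * s12 - 2 * q * m2 - 2 * q * k * m1"
  have AE: "AE x in M. 0 \<le> fst x \<and> 0 \<le> snd x"
    and [simp]: "integrable M fst" "integrable M snd" "integrable M (\<lambda>x. (fst x)\<^sup>2)"
      "integrable M (\<lambda>x. (snd x)\<^sup>2)" "integrable M (\<lambda>x. fst x * snd x)"
    and [simp]: "expectation fst = m1" "expectation snd = m2"
      "expectation (\<lambda>x. (fst x)\<^sup>2) = s1" "expectation (\<lambda>x. (snd x)\<^sup>2) = s2"
      "expectation (\<lambda>x. fst x * snd x) = s12"
    using M by (auto simp: has_bochner_integral_iff)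
  have w: "integrable M ?w" "expectation ?w = m2 + k * m1 - q"
    by (simp_all add: prob_space)
  have sq: "(?w x)\<^sup>2 = (snd x)\<^sup>2 + k\<^sup>2 * (fst x)\<^sup>2 + q\<^sup>2 + 2 * k * (fst x * snd x)
      - 2 * q * snd x - 2 * q * k * fst x" for x :: "real \<times> real"
    by (simp add: power2_eq_square algebra_simps)
  have w2: "integrable M (\<lambda>x. (?w x)\<^sup>2)" "expectation (\<lambda>x. (?w x)\<^sup>2) = ?S"
    unfolding sq by (simp_all add: prob_space)
  have "expected_excess q M \<le> expectation (\<lambda>x. (\<bar>?w x\<bar> + ?w x) / 2)"
    unfolding expected_excess_def
  proof (rule integral_mono_AE)
    show "AE x in M. max (fst x + snd x - q) 0 \<le> (\<bar>?w x\<bar> + ?w x) / 2"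
      using AE
    proof eventually_elim
      case (elim x)
      then have "fst x \<le> k * fst x" using k mult_right_mono[of 1 k "fst x"] by simp
      then show ?case by (auto simp: abs_if max_def)
    qed
  qed (use w in auto)
  also have "\<dots> = (expectation (\<lambda>x. \<bar>?w x\<bar>) + (m2 + k * m1 - q)) / 2"
    using w by (simp del: Bochner_Integration.integral_diff)
  also have "\<dots> \<le> (sqrt ?S + (m2 + k * m1 - q)) / 2"
    using expectation_abs_le_sqrt[OF w(1) w2(1)] w2(2) by simp
  finally show ?thesis .
qed

theorem lemmaB2p5:
  fixes \<mu>1 \<mu>2 q a b c Q p1 p2 p3 :: real
    and \<theta> :: moments
    and xps :: "((real \<times> real) \<times> real) list"
  assumes "\<mu>1 > 0" and "\<mu>2 > 0" and "q > 0"
    and "a > 1" and "b > 1" and "c \<ge> 0"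
    and "(a - 1) * (b - 1) \<ge> (c - 1)\<^sup>2"
    and \<theta>: "\<theta> = (\<mu>1, \<mu>2, a * \<mu>1\<^sup>2, b * \<mu>2\<^sup>2, c * \<mu>1 * \<mu>2)"
    and Q: "Q = Q_a q \<mu>2 a b c"
    and "2 * (a - c) * q > (a * b - c\<^sup>2) * \<mu>2"
    and "Q \<le> - c * \<mu>2 - a * \<mu>1 + q"
    and p1: "p1 = (a - 1) / (2 * a) + (q * (a - 1) + \<mu>2 * (c - a)) / (2 * a * Q)"
    and p2: "p2 = (a - 1) / (2 * a) - (q * (a - 1) + \<mu>2 * (c - a)) / (2 * a * Q)"
    and p3: "p3 = 1 / a"
    and xps: "xps = [((0, q - Q), p1), ((0, q + Q), p2), ((a * \<mu>1, c * \<mu>2), p3)]"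
  shows "pmf_of_list_wf xps \<and>
         optimal_distribution q \<theta> (discrete_distribution xps) \<and>
         v_P q \<theta> = ereal ((a - 1) / (2 * a) * ((a - c) / (a - 1) * \<mu>2 - (q - Q)))"
proof -
  define V where "V = (a - 1) / (2 * a) * ((a - c) / (a - 1) * \<mu>2 - (q - Q))"
  define t where "t = q * (a - 1) + \<mu>2 * (c - a)"
  \<comment> \<open>All divisions by \<open>Q\<close> in the weights are gathered in
    \<open>r\<close>, making \<open>p1\<close> and \<open>p2\<close> equal to
    \<open>(a - 1 \<plusminus> r) / (2 * a)\<close>.\<close>
  define r where "r = t / Q"
  define k where "k = (q - Q - c * \<mu>2) / (a * \<mu>1)"
  let ?R = "q\<^sup>2 - 2 * q * ((a - c) / (a - 1)) * \<mu>2 + ((a * b - c\<^sup>2) / (a - 1)) * \<mu>2\<^sup>2"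
  have a: "a > 0" "a - 1 > 0" "a \<noteq> 0" "a - 1 \<noteq> 0" using \<open>a > 1\<close> by auto
  have aR: "(a - 1) * ?R = (a - 1) * q\<^sup>2 - 2 * q * (a - c) * \<mu>2 + (a * b - c\<^sup>2) * \<mu>2\<^sup>2"
  proof -
    have "(a - 1) * (q\<^sup>2 - 2 * q * u * \<mu>2 + v * \<mu>2\<^sup>2)
        = (a - 1) * q\<^sup>2 - 2 * q * ((a - 1) * u) * \<mu>2 + (a - 1) * v * \<mu>2\<^sup>2" for u v
      by (simp add: algebra_simps)
    from this[of "(a - c) / (a - 1)" "(a * b - c\<^sup>2) / (a - 1)"] show ?thesis
      by (simp only: nonzero_mult_div_cancel_left times_divide_eq_right a(4) not_False_eq_True)
  qed
  \<comment> \<open>Completing the square in \<open>q\<close>. The remainder is nonnegative by the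
    feasibility condition on \<open>a\<close>, \<open>b\<close>, \<open>c\<close>, which yields both
    \<open>?R \<ge> 0\<close> and the bound on \<open>t\<close> below.\<close>
  have a2R: "(a - 1) * ((a - 1) * ?R) = t\<^sup>2 + a * ((a - 1) * (b - 1) - (c - 1)\<^sup>2) * \<mu>2\<^sup>2"
    unfolding aR t_def by (simp add: power2_eq_square algebra_simps)
  have gap: "0 \<le> a * ((a - 1) * (b - 1) - (c - 1)\<^sup>2) * \<mu>2\<^sup>2"
    using assms(7) a by simp
  have "0 \<le> ?R"
    using a2R gap a by (metis add_nonneg_nonneg zero_le_power2 zero_le_mult_iff not_less)
  then have Q0: "Q \<ge> 0" and Q2: "Q\<^sup>2 = ?R"
    unfolding Q Q_a_def by simp_all
  have aQ2: "(a - 1) * Q\<^sup>2 = (a - 1) * q\<^sup>2 - 2 * q * (a - c) * \<mu>2 + (a * b - c\<^sup>2) * \<mu>2\<^sup>2"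
    using aR Q2 by simp
  have "((a - 1) * Q)\<^sup>2 = (a - 1) * ((a - 1) * ?R)"
    unfolding Q2[symmetric] by (simp add: power2_eq_square)
  then have "t\<^sup>2 \<le> ((a - 1) * Q)\<^sup>2"
    using a2R gap by linarith
  then have t: "\<bar>t\<bar> \<le> (a - 1) * Q"
    using Q0 a by (simp add: abs_le_square_iff [symmetric])
  \<comment> \<open>This survives \<open>Q = 0\<close>: the bound then forces \<open>t = 0\<close>,
    in agreement with \<open>x / 0 = 0\<close>.\<close>
  then have rQ: "r * Q = t"
    unfolding r_def by auto
  \<comment> \<open>Equivalent to nonnegativity of both \<open>p1\<close> and
    \<open>p2\<close>.\<close>
  have r: "\<bar>r\<bar> \<le> a - 1"
    using t Q0 a unfolding r_def by (cases "Q = 0") (auto simp: abs_divide divide_le_eq)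
  have P: "p1 = (a - 1 + r) / (2 * a)" "p2 = (a - 1 - r) / (2 * a)"
    unfolding p1 p2 r_def t_def[symmetric] by (simp_all add: add_divide_distrib diff_divide_distrib)
  have wf: "pmf_of_list_wf xps"
    unfolding pmf_of_list_wf_def xps using r a by (auto simp: P p3 field_simps)
  have V: "V = ((a - 1) * (Q - q) + (a - c) * \<mu>2) / (2 * a)"
    unfolding V_def using a by (simp add: field_simps)
  \<comment> \<open>Keeping the value \<open>y\<close> separate lets each claimed moment match
    directly, leaving an identity in the atoms and weights.\<close>
  have int: "has_bochner_integral (discrete_distribution xps) f y"
    if "continuous_on UNIV f"
      "p1 * f (0, q - Q) + p2 * f (0, q + Q) + p3 * f (a * \<mu>1, c * \<mu>2) = y" for f y
    using has_bochner_integral_discrete_distribution[OF wf borel_measurable_continuous_onI[OF that(1)]] that(2)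
    by (simp add: xps add.assoc)
  have nonneg: "0 \<le> a * \<mu>1" "0 \<le> c * \<mu>2"
    using assms(1,2,6) a by auto
  have ex2: "p1 * (q - Q) + p2 * (q + Q) + p3 * (c * \<mu>2) = \<mu>2"
  proof -
    have "p1 * (q - Q) + p2 * (q + Q) + p3 * (c * \<mu>2) = ((a - 1) * q - r * Q + c * \<mu>2) / a"
      unfolding P p3 using a by (simp add: field_simps)
    also have "\<dots> = \<mu>2"
      unfolding rQ t_def using a by (simp add: field_simps)
    finally show ?thesis .
  qed
  have ex22: "p1 * (q - Q)\<^sup>2 + p2 * (q + Q)\<^sup>2 + p3 * (c * \<mu>2)\<^sup>2 = b * \<mu>2\<^sup>2"
  proof -
    have "p1 * (q - Q)\<^sup>2 + p2 * (q + Q)\<^sup>2 + p3 * (c * \<mu>2)\<^sup>2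
        = ((a - 1) * q\<^sup>2 + (a - 1) * Q\<^sup>2 - 2 * q * (r * Q) + c\<^sup>2 * \<mu>2\<^sup>2) / a"
      unfolding P p3 using a by (simp add: field_simps power2_eq_square)
    also have "\<dots> = b * \<mu>2\<^sup>2"
      unfolding rQ aQ2 t_def using a by (simp add: field_simps power2_eq_square)
    finally show ?thesis .
  qed
  have mem: "discrete_distribution xps \<in> moment_set \<theta>"
    unfolding \<theta> moment_set.simps mem_Collect_eq
  proof (intro conjI)
    show "AE x in discrete_distribution xps. 0 \<le> fst x \<and> 0 \<le> snd x"
    proof (rule AE_discrete_distribution[OF wf])
      show "Measurable.pred borel (\<lambda>x::real \<times> real. 0 \<le> fst x \<and> 0 \<le> snd x)"
        unfolding borel_prod[symmetric] by measurable
    \<comment> \<open>The atom \<open>(0, q - Q)\<close> lies in the quadrant because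
      \<open>q - Q \<ge> a * \<mu>1 + c * \<mu>2 \<ge> 0\<close>.\<close>
    qed (use assms(3,11) Q0 nonneg in \<open>auto simp: xps\<close>)
    show "has_bochner_integral (discrete_distribution xps) (\<lambda>x. fst x) \<mu>1"
      "has_bochner_integral (discrete_distribution xps) (\<lambda>x. (fst x)\<^sup>2) (a * \<mu>1\<^sup>2)"
      "has_bochner_integral (discrete_distribution xps) (\<lambda>x. fst x * snd x) (c * \<mu>1 * \<mu>2)"
      \<comment> \<open>Only the third atom has a nonzero first coordinate, so these moments reduce
        to \<open>1 / a\<close> times its contribution.\<close>
      using a by (auto intro!: int continuous_intros simp: p3 power2_eq_square)
    show "has_bochner_integral (discrete_distribution xps) (\<lambda>x. snd x) \<mu>2"
      "has_bochner_integral (discrete_distribution xps) (\<lambda>x. (snd x)\<^sup>2) (b * \<mu>2\<^sup>2)"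
      using ex2 ex22 by (auto intro!: int continuous_intros)
    show "sets (discrete_distribution xps) = sets borel"
      by (simp add: discrete_distribution_def)
  qed (rule prob_space_discrete_distribution)
  have val: "expected_excess q (discrete_distribution xps) = V"
  proof -
    \<comment> \<open>The first and third atoms have no excess and the second has excess
      \<open>Q\<close>, so the expectation is \<open>p2 * Q\<close>.\<close>
    have "a * \<mu>1 + c * \<mu>2 - q \<le> 0"
      using assms(11) Q0 by simp
    moreover have "p2 * Q = V"
    proof -
      have "p2 * Q = ((a - 1) * Q - r * Q) / (2 * a)"
        unfolding P by (simp add: algebra_simps)
      then show ?thesis unfolding rQ t_def V by (simp add: algebra_simps)
    qed
    ultimately show ?thesis
      unfolding expected_excess_def using Q0
      by (intro has_bochner_integral_integral_eq int) (auto intro!: continuous_intros)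
  qed
  have le: "expected_excess q M \<le> V" if "M \<in> moment_set \<theta>" for M
  proof -
    have ak: "a * (k * \<mu>1) = q - Q - c * \<mu>2"
      unfolding k_def using assms(1) a by simp
    have k: "k \<ge> 1"
      unfolding k_def using assms(1,11) a by (simp add: le_divide_eq)
    let ?S = "b * \<mu>2\<^sup>2 + k\<^sup>2 * (a * \<mu>1\<^sup>2) + q\<^sup>2 + 2 * k * (c * \<mu>1 * \<mu>2) - 2 * q * \<mu>2 - 2 * q * k * \<mu>1"
    \<comment> \<open>Grouped so that \<open>k\<close> occurs only through
      \<open>a * (k * \<mu>1)\<close>. After substituting \<open>ak\<close>, the last product is a
      difference of squares, \<open>Q\<^sup>2 - (q - c * \<mu>2)\<^sup>2\<close>, and the remaining
      terms add up to \<open>(a - 1) * Q\<^sup>2\<close> by \<open>aQ2\<close>.\<close>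
    have "a * ?S = a * (b * \<mu>2\<^sup>2 + q\<^sup>2 - 2 * q * \<mu>2)
        + (a * (k * \<mu>1)) * (a * (k * \<mu>1) + 2 * c * \<mu>2 - 2 * q)"
      by (simp add: power2_eq_square algebra_simps)
    also have "\<dots> = (a - 1) * Q\<^sup>2 + Q\<^sup>2"
      unfolding ak aQ2 by (simp add: power2_eq_square algebra_simps)
    also have "\<dots> = a * Q\<^sup>2"
      by (simp add: algebra_simps)
    finally have "?S = Q\<^sup>2"
      unfolding mult_left_cancel[OF a(3)] .
    moreover have "\<mu>2 + k * \<mu>1 - q = ((a - 1) * (- q) - Q + (a - c) * \<mu>2) / a"
      using ak a by (simp add: field_simps)
    ultimately have "(sqrt ?S + (\<mu>2 + k * \<mu>1 - q)) / 2 = V"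
      unfolding V using a Q0 by (simp add: field_simps)
    then show ?thesis
      using expected_excess_le[OF that[unfolded \<theta>] k, of q] by simp
  qed
  have "v_P q \<theta> = ereal V"
    unfolding v_P_def
  proof (rule antisym)
    show "(SUP M\<in>moment_set \<theta>. ereal (expected_excess q M)) \<le> ereal V"
      using le by (intro SUP_least) simp
    show "ereal V \<le> (SUP M\<in>moment_set \<theta>. ereal (expected_excess q M))"
      using mem val by (intro SUP_upper2) auto
  qed
  then show ?thesis
    using wf mem val by (simp add: optimal_distribution_def V_def)
qed

end
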